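(* Let $G=(V,E)$ be a connected graph. The following two statements are equivalent. (1) $(e,f)\in\overline{\Theta}_G$ for all non-adjacent edges $e,f$ of $G$. (2) $G$ is a block graph.
   Context: Graphs are simple and undirected, with non-empty vertex set; $d$ is the shortest-path distance in $G$. For edges $e=\{a,b\}$ and $f=\{x,y\}$ the relation $\Theta_G$ on $E(G)$ is defined by $(e,f)\in\Theta_G$ iff $d(a,x)+d(b,y)\neq d(a,y)+d(b,x)$. The relation $\overline{\Theta}_G$ on $E(G)$ is defined by $(e,f)\in\overline{\Theta}_G$ iff $e=f$, or $e\neq f$ and $(e,f)\notin\Theta_G$. Two edges $e,f$ are adjacent if $e\cap f\neq\emptyset$, and non-adjacent otherwise. A block graph is a graph in which each maximal biconnected component (block) is a complete graph. *)

theory Defs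
  imports Main
begin

text \<open>
  A graph is given by its vertex set \<open>V\<close> and its set \<open>E\<close> of two-element edges.
  No finiteness is assumed.
\<close>

definition simple_graph :: "'a set \<Rightarrow> 'a set set \<Rightarrow> bool" where
  "simple_graph V E \<longleftrightarrow> V \<noteq> {} \<and> (\<forall>e\<in>E. \<exists>a\<in>V. \<exists>b\<in>V. a \<noteq> b \<and> e = {a, b})"

definition path_betw :: "'a set \<Rightarrow> 'a set set \<Rightarrow> 'a \<Rightarrow> 'a list \<Rightarrow> 'a \<Rightarrow> bool" where
  "path_betw V E u p v \<longleftrightarrow>
     p \<noteq> [] \<and> hd p = u \<and> last p = v \<and> set p \<subseteq> V \<and> distinct p \<and>
     successively (\<lambda>a b. {a, b} \<in> E) p"

text \<open>The graph with no vertices counts as connected here; see \<open>biconnected_graph\<close>.\<close>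

definition connected_graph :: "'a set \<Rightarrow> 'a set set \<Rightarrow> bool" where
  "connected_graph V E \<longleftrightarrow> (\<forall>u\<in>V. \<forall>v\<in>V. \<exists>p. path_betw V E u p v)"

text \<open>
  A path \<open>p\<close>, being a list of vertices, has \<open>length p - 1\<close> edges. The value is unspecified for
  vertices that are not joined by a path.
\<close>

definition graph_dist :: "'a set \<Rightarrow> 'a set set \<Rightarrow> 'a \<Rightarrow> 'a \<Rightarrow> nat" where
  "graph_dist V E u v = (LEAST n. \<exists>p. path_betw V E u p v \<and> length p = Suc n)"

definition Theta :: "'a set \<Rightarrow> 'a set set \<Rightarrow> ('a set \<times> 'a set) set" where
  "Theta V E = {(e, f). e \<in> E \<and> f \<in> E \<and>
     (\<exists>a b x y. e = {a, b} \<and> f = {x, y} \<and>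
        graph_dist V E a x + graph_dist V E b y \<noteq> graph_dist V E a y + graph_dist V E b x)}"

text \<open>The existential choice of end point names in \<open>Theta\<close> is immaterial.\<close>

lemma Theta_iff:
  assumes "{a, b} \<in> E" and "{x, y} \<in> E"
  shows "({a, b}, {x, y}) \<in> Theta V E \<longleftrightarrow>
    graph_dist V E a x + graph_dist V E b y \<noteq> graph_dist V E a y + graph_dist V E b x"
  using assms unfolding Theta_def by (auto simp: doubleton_eq_iff)

definition Theta_bar :: "'a set \<Rightarrow> 'a set set \<Rightarrow> ('a set \<times> 'a set) set" where
  "Theta_bar V E = {(e, f). e \<in> E \<and> f \<in> E \<and> (e = f \<or> e \<noteq> f \<and> (e, f) \<notin> Theta V E)}"

definition adjacent_edges :: "'a set \<Rightarrow> 'a set \<Rightarrow> bool" where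
  "adjacent_edges e f \<longleftrightarrow> e \<inter> f \<noteq> {}"

definition subgraph :: "'a set \<Rightarrow> 'a set set \<Rightarrow> 'a set \<Rightarrow> 'a set set \<Rightarrow> bool" where
  "subgraph W F V E \<longleftrightarrow> simple_graph W F \<and> W \<subseteq> V \<and> F \<subseteq> E"

text \<open>
  Biconnected means connected without a cut vertex. As usual for block decompositions, the
  complete graph on two vertices is biconnected, so that bridges are blocks; so is the graph
  with a single vertex, which is a block only if that vertex is isolated.
\<close>

definition biconnected_graph :: "'a set \<Rightarrow> 'a set set \<Rightarrow> bool" where
  "biconnected_graph V E \<longleftrightarrow>
     connected_graph V E \<and> (\<forall>v\<in>V. connected_graph (V - {v}) {e \<in> E. v \<notin> e})"

definition is_block :: "'a set \<Rightarrow> 'a set set \<Rightarrow> 'a set \<Rightarrow> 'a set set \<Rightarrow> bool" where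
  "is_block W F V E \<longleftrightarrow>
     subgraph W F V E \<and> biconnected_graph W F \<and>
     (\<forall>W' F'. subgraph W' F' V E \<and> biconnected_graph W' F' \<and> W \<subseteq> W' \<and> F \<subseteq> F'
        \<longrightarrow> W' = W \<and> F' = F)"

definition complete_graph :: "'a set \<Rightarrow> 'a set set \<Rightarrow> bool" where
  "complete_graph V E \<longleftrightarrow> simple_graph V E \<and> (\<forall>u\<in>V. \<forall>v\<in>V. u \<noteq> v \<longrightarrow> {u, v} \<in> E)"

definition block_graph :: "'a set \<Rightarrow> 'a set set \<Rightarrow> bool" where
  "block_graph V E \<longleftrightarrow>
     simple_graph V E \<and> (\<forall>W F. is_block W F V E \<longrightarrow> complete_graph W F)"

end

theory Submission
  imports Defs
begin

text \<open>
  For an edge \<open>ab\<close> put \<open>f z = d(a, z) - d(b, z)\<close>; condition (1) says that \<open>f\<close> takes equal values at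
  the ends of every edge disjoint from \<open>ab\<close>.

  Assume (1) and let \<open>b, x\<^sub>1, \<dots>, x\<^sub>k, a\<close> be a cycle. Then \<open>f\<close> is constant on \<open>x\<^sub>1, \<dots>, x\<^sub>k\<close>. As
  \<open>f x\<^sub>1 = d(a, x\<^sub>1) - 1 \<ge> 0\<close> and \<open>f x\<^sub>k = 1 - d(b, x\<^sub>k) \<le> 0\<close>, the constant is \<open>0\<close> and \<open>a\<close> is adjacent
  to \<open>x\<^sub>1\<close>. So deleting a vertex of a cycle leaves a cycle, and by induction the vertices of a cycle
  form a clique. In a block, if \<open>w\<close> is a common neighbour of \<open>u\<close> and \<open>v\<close>, then \<open>w\<close> lies on a cycle
  with \<open>u\<close> and \<open>v\<close> because it is not a cut vertex; hence adjacency is transitive in a block.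

  Conversely, in a block graph the vertices of a cycle form a clique. If (1) fails for \<open>ab\<close> and
  \<open>xy\<close>, we may assume \<open>f x = -1\<close> and \<open>f y \<ge> 0\<close>. All vertices \<open>z\<close> of a geodesic from \<open>a\<close> to \<open>x\<close> have
  \<open>f z = -1\<close>, and those of a geodesic from \<open>b\<close> to \<open>y\<close> have \<open>f z \<ge> 0\<close>. So the two geodesics are disjoint
  and form a cycle with \<open>ab\<close> and \<open>xy\<close>, whence \<open>d(a, x) = d(b, x) = 1\<close>, a contradiction.
\<close>

section \<open>Walks, paths and connectedness\<close>

text \<open>Without \<open>distinct\<close>, concatenation needs no disjointness of the two pieces;
  \<open>walk_imp_path\<close> leads back to paths.\<close>

definition walk_betw :: "'a set \<Rightarrow> 'a set set \<Rightarrow> 'a \<Rightarrow> 'a list \<Rightarrow> 'a \<Rightarrow> bool" where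
  "walk_betw V E u p v \<longleftrightarrow>
     p \<noteq> [] \<and> hd p = u \<and> last p = v \<and> set p \<subseteq> V \<and> successively (\<lambda>a b. {a, b} \<in> E) p"

lemma path_betw_iff_walk: "path_betw V E u p v \<longleftrightarrow> walk_betw V E u p v \<and> distinct p"
  by (auto simp: path_betw_def walk_betw_def)

text \<open>Cutting out the part between two occurrences of a vertex shortens a walk. The length
  bound is kept so that walks can bound distances from above.\<close>

lemma walk_imp_path:
  assumes "walk_betw V E u p v"
  shows "\<exists>q. path_betw V E u q v \<and> length q \<le> length p"
  using assms
proof (induction "length p" arbitrary: p rule: less_induct)
  case less
  show ?case
  proof (cases "distinct p")
    case True
    then have "path_betw V E u p v" using less.prems by (simp add: path_betw_iff_walk)
    then show ?thesis by blast
  next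
    case False
    then obtain xs y ys zs where p: "p = xs @ [y] @ ys @ [y] @ zs"
      using not_distinct_decomp[of p] by blast
    have "walk_betw V E u (xs @ [y] @ zs) v"
      using less.prems unfolding p walk_betw_def
      by (cases xs; cases zs) (auto simp: successively_append_iff successively_Cons hd_append)
    then show ?thesis
      using less.hyps[of "xs @ [y] @ zs"] unfolding p by (fastforce intro: le_trans)
  qed
qed

lemma walk_rev: "walk_betw V E u p v \<Longrightarrow> walk_betw V E v (rev p) u"
  by (auto simp: walk_betw_def hd_rev last_rev insert_commute)

lemma walk_trans:
  assumes "walk_betw V E u p v" and "walk_betw V E v q w"
  shows "walk_betw V E u (p @ tl q) w"
  using assms by (cases q) (auto simp: walk_betw_def successively_append_iff successively_Cons)

lemma walk_mono: "walk_betw V E u p v \<Longrightarrow> V \<subseteq> V' \<Longrightarrow> E \<subseteq> E' \<Longrightarrow> walk_betw V' E' u p v"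
  unfolding walk_betw_def by (auto elim: successively_mono)

definition joined :: "'a set \<Rightarrow> 'a set set \<Rightarrow> 'a \<Rightarrow> 'a \<Rightarrow> bool" where
  "joined V E u v \<longleftrightarrow> (\<exists>p. walk_betw V E u p v)"

lemma connected_graph_iff_joined: "connected_graph V E \<longleftrightarrow> (\<forall>u\<in>V. \<forall>v\<in>V. joined V E u v)"
  unfolding connected_graph_def joined_def using walk_imp_path path_betw_iff_walk by metis

lemma joined_sym: "joined V E u v \<Longrightarrow> joined V E v u"
  unfolding joined_def using walk_rev by metis

lemma joined_trans: "joined V E u v \<Longrightarrow> joined V E v w \<Longrightarrow> joined V E u w"
  unfolding joined_def using walk_trans by metis

lemma joined_mono: "joined V E u v \<Longrightarrow> V \<subseteq> V' \<Longrightarrow> E \<subseteq> E' \<Longrightarrow> joined V' E' u v"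
  unfolding joined_def using walk_mono by metis

text \<open>A prefix of \<open>p\<close> joins \<open>hd p\<close> to each entry. The empty list is
  covered because the empty graph counts as connected.\<close>

lemma connected_graph_list:
  assumes "successively (\<lambda>a b. {a, b} \<in> E) p"
  shows "connected_graph (set p) {e \<in> E. e \<subseteq> set p}"
proof -
  have "joined (set p) {e \<in> E. e \<subseteq> set p} (hd p) x" if x: "x \<in> set p" for x
  proof -
    obtain ys zs where p: "p = ys @ x # zs" using x by (meson split_list)
    have "successively (\<lambda>a b. {a, b} \<in> {e \<in> E. e \<subseteq> set p}) p"
      by (rule successively_mono[OF assms]) auto
    then have "walk_betw (set p) {e \<in> E. e \<subseteq> set p} (hd p) (ys @ [x]) x"
      unfolding walk_betw_def
      by (subst (asm) (2) p) (auto simp: p hd_append successively_append_iff)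
    then show ?thesis unfolding joined_def by blast
  qed
  then show ?thesis
    unfolding connected_graph_iff_joined by (meson joined_sym joined_trans)
qed

section \<open>Closed paths and blocks\<close>

text \<open>A single edge, as a list \<open>[a, b]\<close>, also counts as closed; it is the base
  case when cycles are shortened one vertex at a time.\<close>

definition closed_path :: "'a set set \<Rightarrow> 'a list \<Rightarrow> bool" where
  "closed_path E p \<longleftrightarrow>
     distinct p \<and> successively (\<lambda>a b. {a, b} \<in> E) p \<and> {last p, hd p} \<in> E"

lemma simple_graph_edge:
  assumes "simple_graph V E" and "{a, b} \<in> E"
  shows "a \<in> V" and "b \<in> V" and "a \<noteq> b"
  using assms unfolding simple_graph_def by (fastforce simp: doubleton_eq_iff)+

text \<open>Allowing \<open>v\<close> outside \<open>W\<close> serves the union of biconnected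
  subgraphs, where a deleted vertex may belong to only some of them.\<close>

lemma biconnected_graph_delete:
  assumes "simple_graph W F" and "biconnected_graph W F"
  shows "connected_graph (W - {v}) {e \<in> F. v \<notin> e}"
proof (cases "v \<in> W")
  case True
  then show ?thesis using assms by (simp add: biconnected_graph_def)
next
  case False
  then have "W - {v} = W" and "{e \<in> F. v \<notin> e} = F"
    using assms(1) by (auto simp: simple_graph_def)
  then show ?thesis using assms by (simp add: biconnected_graph_def)
qed

lemma closed_path_biconnected:
  assumes "closed_path E p"
  shows "biconnected_graph (set p) {e \<in> E. e \<subseteq> set p}"
  unfolding biconnected_graph_def
proof (intro conjI ballI)
  show "connected_graph (set p) {e \<in> E. e \<subseteq> set p}"
    using assms by (intro connected_graph_list) (simp add: closed_path_def)
  fix v assume "v \<in> set p"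
  then obtain xs ys where p: "p = xs @ v # ys" by (meson split_list)
  \<comment> \<open>Going round the cycle from the successor of \<open>v\<close>, the closing edge
    links the end of \<open>ys\<close> to the start of \<open>xs\<close>.\<close>
  have "successively (\<lambda>a b. {a, b} \<in> E) (ys @ xs)"
    using assms unfolding closed_path_def p
    by (cases "xs = []"; cases "ys = []") (auto simp: successively_append_iff successively_Cons)
  moreover have "set (ys @ xs) = set p - {v}"
    using assms unfolding closed_path_def p by auto
  moreover have "{e \<in> E. e \<subseteq> set p - {v}} = {e \<in> {e \<in> E. e \<subseteq> set p}. v \<notin> e}"
    by auto
  ultimately show "connected_graph (set p - {v}) {e \<in> {e \<in> E. e \<subseteq> set p}. v \<notin> e}"
    using connected_graph_list[of E "ys @ xs"] by simp
qed

text \<open>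
  The block is the union of all biconnected subgraphs containing the edge \<open>e\<close>: any two of them
  share both ends of \<open>e\<close>, and only one of the ends can be deleted.
\<close>

lemma biconnected_subgraph_in_block:
  assumes W: "subgraph W F V E" "biconnected_graph W F" and e: "e \<in> F"
  shows "\<exists>W' F'. is_block W' F' V E \<and> W \<subseteq> W' \<and> F \<subseteq> F'"
proof -
  define B where "B = {(W, F). subgraph W F V E \<and> biconnected_graph W F \<and> e \<in> F}"
  define W' where "W' = (\<Union>(W, F)\<in>B. W)"
  define F' where "F' = (\<Union>(W, F)\<in>B. F)"
  have sg: "simple_graph X Y" and bc: "biconnected_graph X Y" and eY: "e \<in> Y"
    and le: "X \<subseteq> W'" "Y \<subseteq> F'" if "(X, Y) \<in> B" for X Y
    using that unfolding B_def W'_def F'_def subgraph_def by auto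
  have WB: "(W, F) \<in> B" using assms by (auto simp: B_def)
  obtain a b where ab: "e = {a, b}" "a \<noteq> b"
    using sg[OF WB] e unfolding simple_graph_def by meson
  have abX: "a \<in> X" "b \<in> X" if "(X, Y) \<in> B" for X Y
    using simple_graph_edge[OF sg[OF that]] eY[OF that] ab by auto
  have sub: "subgraph W' F' V E"
    unfolding subgraph_def simple_graph_def
  proof (intro conjI ballI)
    show "W' \<noteq> {}" using abX[OF WB] le[OF WB] by auto
    show "W' \<subseteq> V" "F' \<subseteq> E" unfolding W'_def F'_def B_def subgraph_def by auto
    fix g assume "g \<in> F'"
    then obtain X Y where XY: "(X, Y) \<in> B" "g \<in> Y" unfolding F'_def by auto
    then obtain s t where "s \<in> X" "t \<in> X" "s \<noteq> t" "g = {s, t}"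
      using sg[OF XY(1)] unfolding simple_graph_def by meson
    then show "\<exists>s\<in>W'. \<exists>t\<in>W'. s \<noteq> t \<and> g = {s, t}" using le[OF XY(1)] by blast
  qed
  have "connected_graph W' F'"
    unfolding connected_graph_iff_joined
  proof (intro ballI)
    have *: "joined W' F' s a" if s: "s \<in> W'" for s
    proof -
      obtain X Y where XY: "(X, Y) \<in> B" "s \<in> X" using s unfolding W'_def by auto
      then have "joined X Y s a"
        using bc[OF XY(1)] abX[OF XY(1)]
        by (auto simp: biconnected_graph_def connected_graph_iff_joined)
      then show ?thesis using joined_mono le[OF XY(1)] by metis
    qed
    fix s t assume "s \<in> W'" "t \<in> W'"
    then show "joined W' F' s t" using joined_trans[OF * joined_sym[OF *]] by blast
  qed
  moreover have "connected_graph (W' - {v}) {g \<in> F'. v \<notin> g}" for v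
    unfolding connected_graph_iff_joined
  proof (intro ballI)
    obtain c where c: "c \<in> {a, b}" "c \<noteq> v" using ab by blast
    have *: "joined (W' - {v}) {g \<in> F'. v \<notin> g} s c" if s: "s \<in> W' - {v}" for s
    proof -
      obtain X Y where XY: "(X, Y) \<in> B" "s \<in> X" using s unfolding W'_def by auto
      then have "joined (X - {v}) {g \<in> Y. v \<notin> g} s c"
        using biconnected_graph_delete[OF sg[OF XY(1)] bc[OF XY(1)], of v] abX[OF XY(1)] c s
        by (auto simp: connected_graph_iff_joined)
      then show ?thesis by (rule joined_mono) (use le[OF XY(1)] in auto)
    qed
    fix s t assume "s \<in> W' - {v}" "t \<in> W' - {v}"
    then show "joined (W' - {v}) {g \<in> F'. v \<notin> g} s t"
      using joined_trans[OF * joined_sym[OF *]] by blast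
  qed
  ultimately have bi: "biconnected_graph W' F'" by (simp add: biconnected_graph_def)
  have "X = W' \<and> Y = F'"
    if "subgraph X Y V E" "biconnected_graph X Y" "W' \<subseteq> X" "F' \<subseteq> Y" for X Y
  proof -
    \<comment> \<open>A biconnected subgraph above the union still contains \<open>e\<close>, so it
      is itself a member of the family and lies inside the union.\<close>
    have "(X, Y) \<in> B" using that eY[OF WB] le[OF WB] by (auto simp: B_def)
    then show ?thesis using le that by blast
  qed
  then have "is_block W' F' V E" unfolding is_block_def using sub bi by blast
  then show ?thesis using le[OF WB] by blast
qed

text \<open>The subgraph induced on the cycle is biconnected, hence contained in a block, and that
  block is complete.\<close>

lemma block_graph_closed_path_clique:
  assumes "block_graph V E" and p: "closed_path E p" "set p \<subseteq> V" "p \<noteq> []"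
    and xy: "x \<in> set p" "y \<in> set p" "x \<noteq> y"
  shows "{x, y} \<in> E"
proof -
  let ?F = "{e \<in> E. e \<subseteq> set p}"
  have "subgraph (set p) ?F V E"
    unfolding subgraph_def simple_graph_def
  proof (intro conjI ballI)
    fix e assume e: "e \<in> ?F"
    then obtain s t where "s \<noteq> t" "e = {s, t}"
      using assms(1) unfolding block_graph_def simple_graph_def by (metis (lifting) mem_Collect_eq)
    then show "\<exists>s\<in>set p. \<exists>t\<in>set p. s \<noteq> t \<and> e = {s, t}" using e by blast
  qed (use p in auto)
  moreover have "{last p, hd p} \<in> ?F" using p by (auto simp: closed_path_def)
  ultimately obtain W' F' where W': "is_block W' F' V E" "set p \<subseteq> W'"
    using biconnected_subgraph_in_block closed_path_biconnected[OF p(1)] by metis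
  then have "complete_graph W' F'" using assms(1) by (auto simp: block_graph_def)
  then have "{x, y} \<in> F'" using xy W'(2) by (auto simp: complete_graph_def)
  then show ?thesis using W'(1) by (auto simp: is_block_def subgraph_def)
qed

section \<open>Distances\<close>

locale connected_simple_graph =
  fixes V :: "'a set" and E :: "'a set set"
  assumes simple: "simple_graph V E" and conn: "connected_graph V E"
begin

abbreviation d :: "'a \<Rightarrow> 'a \<Rightarrow> nat" where
  "d \<equiv> graph_dist V E"

lemmas edgeD = simple_graph_edge[OF simple]

lemma geodesic:
  assumes "u \<in> V" and "v \<in> V"
  obtains p where "path_betw V E u p v" and "length p = Suc (d u v)"
proof -
  obtain p where p: "path_betw V E u p v"
    using conn assms by (auto simp: connected_graph_def)
  then have "length p = Suc (length p - 1)" by (cases p) (auto simp: path_betw_def)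
  then have "\<exists>n q. path_betw V E u q v \<and> length q = Suc n" using p by blast
  from LeastI_ex[OF this] show thesis using that unfolding graph_dist_def by blast
qed

text \<open>Stated for walks rather than paths, so that concatenating geodesics yields the triangle
  inequality.\<close>

lemma dist_le_walk:
  assumes "walk_betw V E u p v"
  shows "Suc (d u v) \<le> length p"
proof -
  obtain q where q: "path_betw V E u q v" "length q \<le> length p"
    using walk_imp_path[OF assms] by blast
  then have "length q = Suc (length q - 1)" by (cases q) (auto simp: path_betw_def)
  then have "d u v \<le> length q - 1"
    unfolding graph_dist_def using q by (intro Least_le) blast
  then show ?thesis using q \<open>length q = Suc (length q - 1)\<close> by linarith
qed

lemma geodesic_walk:
  assumes "u \<in> V" and "v \<in> V"
  obtains p where "walk_betw V E u p v" and "length p = Suc (d u v)"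
  using geodesic[OF assms] path_betw_iff_walk by metis

lemma dist_triangle:
  assumes "u \<in> V" and "v \<in> V" and "w \<in> V"
  shows "d u w \<le> d u v + d v w"
proof -
  obtain p q where p: "walk_betw V E u p v" "length p = Suc (d u v)"
    and q: "walk_betw V E v q w" "length q = Suc (d v w)"
    using geodesic_walk assms by metis
  show ?thesis using dist_le_walk[OF walk_trans[OF p(1) q(1)]] p(2) q(2) by simp
qed

lemma dist_eq_0:
  assumes "u \<in> V" and "v \<in> V" and "d u v = 0"
  shows "u = v"
proof -
  obtain p where "walk_betw V E u p v" "length p = Suc (d u v)"
    using geodesic_walk[OF assms(1,2)] .
  then show ?thesis using assms(3) by (auto simp: walk_betw_def length_Suc_conv)
qed

lemma dist_eq_1_iff:
  assumes "u \<in> V" and "v \<in> V"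
  shows "d u v = 1 \<longleftrightarrow> {u, v} \<in> E"
proof
  assume "{u, v} \<in> E"
  then have "walk_betw V E u [u, v] v" "u \<noteq> v" using assms edgeD by (auto simp: walk_betw_def)
  then show "d u v = 1" using dist_le_walk dist_eq_0[OF assms] by fastforce
next
  assume "d u v = 1"
  moreover obtain p where "walk_betw V E u p v" "length p = Suc (d u v)"
    using geodesic_walk[OF assms] .
  ultimately show "{u, v} \<in> E" by (auto simp: walk_betw_def length_Suc_conv)
qed

lemma dist_edge_le:
  assumes "{a, b} \<in> E" and "z \<in> V"
  shows "d a z \<le> Suc (d b z)"
  using dist_triangle[of a b z] dist_eq_1_iff[of a b] edgeD[OF assms(1)] assms by simp

text \<open>Splitting the geodesic at \<open>z\<close> gives two walks with \<open>d u v\<close>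
  edges in total, so the triangle inequality is tight at \<open>z\<close>.\<close>

lemma geodesic_vertex:
  assumes p: "path_betw V E u p v" "length p = Suc (d u v)" and z: "z \<in> set p"
  shows "z \<in> V" and "d u v = d u z + d z v"
proof -
  have w: "walk_betw V E u p v" using p by (simp add: path_betw_iff_walk)
  then have uv: "u \<in> V" "v \<in> V" by (auto simp: walk_betw_def)
  show zV: "z \<in> V" using w z by (auto simp: walk_betw_def)
  obtain xs ys where xs: "p = xs @ z # ys" using z by (meson split_list)
  have "walk_betw V E u (xs @ [z]) z" "walk_betw V E z (z # ys) v"
    using w unfolding xs walk_betw_def by (auto simp: hd_append successively_append_iff)
  then have "d u z \<le> length xs" "d z v \<le> length ys"
    using dist_le_walk by fastforce+
  then show "d u v = d u z + d z v"
    using dist_triangle[OF uv(1) zV uv(2)] p(2) xs by simp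
qed

section \<open>From block graphs to condition (1)\<close>

lemma block_graph_opposite_sides:
  assumes bg: "block_graph V E" and ab: "{a, b} \<in> E" and xy: "{x, y} \<in> E"
    and disj: "{a, b} \<inter> {x, y} = {}" and x: "d b x = Suc (d a x)" and y: "d b y \<le> d a y"
  shows False
proof -
  note V = edgeD[OF ab] edgeD[OF xy]
  obtain p where p: "path_betw V E a p x" "length p = Suc (d a x)" using geodesic V by metis
  obtain q where q: "path_betw V E b q y" "length q = Suc (d b y)" using geodesic V by metis
  \<comment> \<open>Combine \<open>d a x = d a z + d z x\<close> with
    \<open>d b x \<le> d b z + d z x\<close> and \<open>d a x < d b x\<close>; the bound on
    \<open>q\<close> is analogous.\<close>
  have "d a z < d b z" if z: "z \<in> set p" for z
    using geodesic_vertex[OF p z] dist_triangle[of b z x] V x by simp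
  moreover have "d b z \<le> d a z" if z: "z \<in> set q" for z
    using geodesic_vertex[OF q z] dist_triangle[of a z y] V y by simp
  ultimately have pq: "set p \<inter> set q = {}" by fastforce
  \<comment> \<open>The cycle follows \<open>p\<close> from \<open>a\<close> to \<open>x\<close>,
    crosses to \<open>y\<close>, returns along \<open>q\<close> to \<open>b\<close> and closes with
    the edge \<open>ab\<close>.\<close>
  have "closed_path E (p @ rev q)" "set (p @ rev q) \<subseteq> V" "p @ rev q \<noteq> []"
    using p(1) q(1) pq ab xy
    by (auto simp: closed_path_def path_betw_def successively_append_iff hd_rev last_rev insert_commute)
  moreover have "a \<in> set p" "x \<in> set p" "b \<in> set q"
    using p(1) q(1) by (auto simp: path_betw_def)
  ultimately have "{a, x} \<in> E" "{b, x} \<in> E"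
    using block_graph_closed_path_clique[OF bg] disj by auto
  then have "d a x = 1" "d b x = 1" using dist_eq_1_iff V by blast+
  then show False using x by simp
qed

lemma block_graph_disjoint_edges:
  assumes bg: "block_graph V E" and ab: "{a, b} \<in> E" and xy: "{x, y} \<in> E"
    and disj: "{a, b} \<inter> {x, y} = {}"
  shows "d a x + d b y = d a y + d b x"
proof -
  have ba: "{b, a} \<in> E" and yx: "{y, x} \<in> E" using ab xy by (simp_all add: insert_commute)
  have le: "d a x \<le> Suc (d b x)" "d b x \<le> Suc (d a x)" "d a y \<le> Suc (d b y)" "d b y \<le> Suc (d a y)"
    using dist_edge_le[OF ab] dist_edge_le[OF ba] edgeD[OF xy] by auto
  \<comment> \<open>Both differences \<open>d a x - d b x\<close> and \<open>d a y - d b y\<close>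
    lie in {-1, 0, 1}. If they differ, one of them is 1 or -1 and the other is not strictly on the
    same side of 0; swapping \<open>a\<close> with \<open>b\<close> and \<open>x\<close> with
    \<open>y\<close> gives the four cases.\<close>
  have "\<not> (d b x = Suc (d a x) \<and> d b y \<le> d a y)" "\<not> (d b y = Suc (d a y) \<and> d b x \<le> d a x)"
    "\<not> (d a x = Suc (d b x) \<and> d a y \<le> d b y)" "\<not> (d a y = Suc (d b y) \<and> d a x \<le> d b x)"
    using block_graph_opposite_sides[OF bg ab xy] block_graph_opposite_sides[OF bg ab yx]
      block_graph_opposite_sides[OF bg ba xy] block_graph_opposite_sides[OF bg ba yx] disj
    by auto
  then show ?thesis using le by linarith
qed

end

section \<open>Graphs in which disjoint edges are unrelated\<close>

lemma successively_eq_hd_last: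
  "successively (\<lambda>x y. f x = f y) q \<Longrightarrow> q \<noteq> [] \<Longrightarrow> f (hd q) = f (last q)"
  by (induction q rule: induct_list012) auto

locale disjoint_edges_unrelated = connected_simple_graph +
  assumes unrelated: "\<And>a b x y. {a, b} \<in> E \<Longrightarrow> {x, y} \<in> E \<Longrightarrow> {a, b} \<inter> {x, y} = {} \<Longrightarrow>
    d a x + d b y = d a y + d b x"
begin

text \<open>This is the shortening step: the edge obtained closes up \<open>q @ [a]\<close> once
  \<open>b\<close> is dropped from the cycle.\<close>

lemma closed_path_chord:
  assumes p: "closed_path E (b # q @ [a])" and q: "q \<noteq> []"
  shows "{a, hd q} \<in> E"
proof -
  define f where "f z = int (d a z) - int (d b z)" for z
  have dist: "distinct (b # q @ [a])" and ab: "{a, b} \<in> E"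
    and sq: "successively (\<lambda>a b. {a, b} \<in> E) q" and hq: "{b, hd q} \<in> E" and lq: "{last q, a} \<in> E"
    using p q by (auto simp: closed_path_def successively_append_iff successively_Cons)
  have "successively (\<lambda>x y. f x = f y) q"
  proof (rule successively_mono[OF sq])
    fix x y assume "x \<in> set q" "y \<in> set q" "{x, y} \<in> E"
    then have "d a x + d b y = d a y + d b x"
      by (intro unrelated[OF ab]) (use dist in auto)
    then show "f x = f y" unfolding f_def by linarith
  qed
  then have "f (hd q) = f (last q)" using q by (rule successively_eq_hd_last)
  moreover have V: "a \<in> V" "b \<in> V" "hd q \<in> V" "last q \<in> V"
    using edgeD[OF ab] edgeD[OF hq] edgeD[OF lq] by auto
  moreover have "d b (hd q) = 1" "d a (last q) = 1"
    using dist_eq_1_iff V hq lq by (simp_all add: insert_commute)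
  moreover have "hd q \<noteq> a" "last q \<noteq> b" using dist q by auto
  then have "d a (hd q) \<noteq> 0" "d b (last q) \<noteq> 0" using dist_eq_0 V by metis+
  ultimately have "d a (hd q) = 1" unfolding f_def by linarith
  then show ?thesis using dist_eq_1_iff V by simp
qed

lemma closed_path_clique:
  assumes "closed_path E p" and "x \<in> set p" and "y \<in> set p" and "x \<noteq> y"
  shows "{x, y} \<in> E"
  using assms
proof (induction "length p" arbitrary: p rule: less_induct)
  case less
  obtain b p' where p': "p = b # p'" using less.prems by (cases p) auto
  then obtain r a where r: "p = b # r @ [a]"
    using less.prems by (cases p' rule: rev_cases) auto
  show ?case
  proof (cases r)
    case Nil
    then show ?thesis using less.prems r by (auto simp: closed_path_def insert_commute)
  next
    case (Cons c q)
    have cl: "closed_path E (b # (c # q) @ [a])" using less.prems r Cons by simp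
    \<comment> \<open>Rotating the cycle by one place lets the chord lemma drop \<open>c\<close>
      instead of \<open>b\<close>.\<close>
    then have cl': "closed_path E (c # (q @ [a]) @ [b])"
      by (auto simp: closed_path_def successively_append_iff successively_Cons hd_append insert_commute)
    have "{a, c} \<in> E" using closed_path_chord[OF cl] by simp
    then have 1: "closed_path E (c # q @ [a])"
      using cl by (auto simp: closed_path_def successively_Cons)
    have "{b, hd (q @ [a])} \<in> E" using closed_path_chord[OF cl'] by simp
    then have 2: "closed_path E (q @ [a, b])"
      using cl' by (auto simp: closed_path_def successively_Cons hd_append)
    have bc: "{b, c} \<in> E" using cl by (simp add: closed_path_def)
    \<comment> \<open>One shorter cycle misses only \<open>b\<close>, the other only
      \<open>c\<close>. The sole pair contained in neither is \<open>b\<close>, \<open>c\<close>,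
      which is an edge of the cycle.\<close>
    consider "x \<in> set (c # q @ [a])" "y \<in> set (c # q @ [a])"
      | "x \<in> set (q @ [a, b])" "y \<in> set (q @ [a, b])" | "{x, y} = {b, c}"
      using less.prems r Cons by auto
    then show ?thesis
      using less.hyps[OF _ 1] less.hyps[OF _ 2] less.prems bc r Cons by cases auto
  qed
qed

lemma block_complete:
  assumes B: "is_block W F V E"
  shows "complete_graph W F"
proof -
  have sub: "simple_graph W F" "W \<subseteq> V" "F \<subseteq> E" and bi: "biconnected_graph W F"
    using B by (auto simp: is_block_def subgraph_def)
  \<comment> \<open>A block is an induced subgraph: an additional edge between its vertices
    preserves biconnectedness, so maximality already puts it in \<open>F\<close>.\<close>
  have max: "{u, v} \<in> F" if uv: "u \<in> W" "v \<in> W" "u \<noteq> v" "{u, v} \<in> E" for u v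
  proof -
    let ?F = "insert {u, v} F"
    have "subgraph W ?F V E"
      using sub uv unfolding subgraph_def simple_graph_def by auto
    moreover have "connected_graph X G'" if "connected_graph X G" "G \<subseteq> G'" for X :: "'a set" and G G'
      using that joined_mono unfolding connected_graph_iff_joined by (metis order_refl)
    then have "biconnected_graph W ?F"
      using bi unfolding biconnected_graph_def
      by (smt (verit) Collect_mono insertCI subset_insertI)
    ultimately have "?F = F" using B unfolding is_block_def by blast
    then show ?thesis by blast
  qed
  \<comment> \<open>Adjacency to \<open>u\<close> is carried along the path, from the last but one
    vertex \<open>w\<close> to the end \<open>v\<close>.\<close>
  have "v = u \<or> {u, v} \<in> F" if "path_betw W F u p v" for u p v
    using that
  proof (induction p arbitrary: v rule: rev_induct)
    case Nil
    then show ?case by (simp add: path_betw_def)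
  next
    case (snoc t p)
    show ?case
    proof (cases "p = []")
      case True
      then show ?thesis using snoc.prems by (auto simp: path_betw_def)
    next
      case False
      define w where "w = last p"
      have p: "path_betw W F u p w" and wv: "{w, v} \<in> F"
        using snoc.prems False by (auto simp: path_betw_def successively_append_iff w_def)
      show ?thesis
      proof (cases "w = u \<or> v = u")
        case True
        then show ?thesis using wv by auto
      next
        case False
        then have uw: "{u, w} \<in> F" using snoc.IH[OF p] by blast
        have V: "u \<in> W" "v \<in> W" "w \<noteq> u" "w \<noteq> v"
          using simple_graph_edge[OF sub(1) uw] simple_graph_edge[OF sub(1) wv] by auto
        \<comment> \<open>As \<open>q\<close> avoids \<open>w\<close>, prepending \<open>w\<close>
          gives a cycle through \<open>u\<close>, \<open>w\<close> and \<open>v\<close>.\<close>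
        then obtain q where q: "path_betw (W - {w}) {e \<in> F. w \<notin> e} u q v"
          using biconnected_graph_delete[OF sub(1) bi, of w] by (auto simp: connected_graph_def)
        have "successively (\<lambda>a b. {a, b} \<in> E) q"
          by (rule successively_mono[where P = "\<lambda>a b. {a, b} \<in> {e \<in> F. w \<notin> e}"])
            (use q sub in \<open>auto simp: path_betw_def\<close>)
        then have "closed_path E (w # q)"
          using q uw wv sub
          by (auto simp: closed_path_def path_betw_def successively_Cons insert_commute)
        moreover have "u \<in> set q" "v \<in> set q" using q by (auto simp: path_betw_def)
        ultimately have "{u, v} \<in> E" using closed_path_clique False by auto
        then show ?thesis using max V False by auto
      qed
    qed
  qed
  then show ?thesis
    using bi sub(1) unfolding complete_graph_def biconnected_graph_def connected_graph_def by metis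
qed

end

theorem proposition3p6:
  fixes V :: "'a set" and E :: "'a set set"
  assumes "simple_graph V E" and "connected_graph V E"
  shows "(\<forall>e\<in>E. \<forall>f\<in>E. \<not> adjacent_edges e f \<longrightarrow> (e, f) \<in> Theta_bar V E)
         \<longleftrightarrow> block_graph V E"
proof
  interpret connected_simple_graph V E using assms by unfold_locales
  assume L: "\<forall>e\<in>E. \<forall>f\<in>E. \<not> adjacent_edges e f \<longrightarrow> (e, f) \<in> Theta_bar V E"
  interpret disjoint_edges_unrelated V E
  proof
    fix a b x y assume ab: "{a, b} \<in> E" and xy: "{x, y} \<in> E" and disj: "{a, b} \<inter> {x, y} = {}"
    then have "({a, b}, {x, y}) \<in> Theta_bar V E" using L by (simp add: adjacent_edges_def)
    moreover have "{a, b} \<noteq> {x, y}" using disj by auto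
    ultimately have "({a, b}, {x, y}) \<notin> Theta V E" by (auto simp: Theta_bar_def)
    then show "d a x + d b y = d a y + d b x" using Theta_iff[OF ab xy] by blast
  qed
  show "block_graph V E" unfolding block_graph_def using simple block_complete by blast
next
  interpret connected_simple_graph V E using assms by unfold_locales
  assume R: "block_graph V E"
  show "\<forall>e\<in>E. \<forall>f\<in>E. \<not> adjacent_edges e f \<longrightarrow> (e, f) \<in> Theta_bar V E"
  proof (intro ballI impI)
    fix e f assume ef: "e \<in> E" "f \<in> E" and disj: "\<not> adjacent_edges e f"
    then obtain a b x y where "e = {a, b}" "f = {x, y}"
      using simple by (metis simple_graph_def)
    then show "(e, f) \<in> Theta_bar V E"
      using block_graph_disjoint_edges[OF R] ef disj Theta_iff[of a b E x y V]
      by (auto simp: Theta_bar_def adjacent_edges_def)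
  qed
qed

end
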